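(* Let $c,k_1,k_2,k_3,k_4$ be real constants, let $W(x,t)=\dfrac{c-x}{6t}$ for $t>0$, and let $$X_\varepsilon=6t\,\partial_x+(2\varepsilon w-1)\,\partial_w+\varepsilon\Big(k_1\,\partial_x+k_2\,\partial_t+k_3(6t\,\partial_x-\partial_w)+k_4(x\,\partial_x+3t\,\partial_t-2w\,\partial_w)\Big),$$ an approximate symmetry of the Gardner equation $w_t-6(w+\varepsilon w^2)w_x+w_{xxx}=0$. Then the functions of the form $w=W(x,t)+\varepsilon v(x,t)$, with $v$ smooth and independent of $\varepsilon$, which are approximately invariant under $X_\varepsilon$ and are approximate solutions of the Gardner equation are $$w=\frac{c-x}{6t}+\varepsilon\left(-\frac{(k_1+k_4c)(c-x)}{36t^2}-k_2\frac{(c-x)^2}{72t^3}-\Big(\frac{c-x}{6t}\Big)^2+\frac{C}{t}\right),$$ where $C$ is an arbitrary real constant.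
   Context: The function $W=(c-x)/(6t)$ is the general Galilean-invariant solution (invariant under $6t\,\partial_x-\partial_w$) of the unperturbed equation (KdV) $w_t-6ww_x+w_{xxx}=0$. Approximations are of first order in $\varepsilon$: $f=o(\varepsilon)$ means $\lim_{\varepsilon\to0}f/\varepsilon=0$. A function $w=W+\varepsilon v(x,t)$ is an approximate solution if $w_t-6(w+\varepsilon w^2)w_x+w_{xxx}=o(\varepsilon)$. It is approximately invariant under $X_\varepsilon$ if, with $X_\varepsilon$ acting as a first-order differential operator on functions of $(x,t,w)$, $$X_\varepsilon\big(w-W(x,t)-\varepsilon v(x,t)\big)\Big|_{w=W(x,t)+\varepsilon v(x,t)}=o(\varepsilon).$$ *)

theory Defs
  imports "HOL-Analysis.Analysis"
begin

definition pdx :: "(real \<Rightarrow> real \<Rightarrow> real) \<Rightarrow> real \<Rightarrow> real \<Rightarrow> real" where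
  "pdx f x t = deriv (\<lambda>s. f s t) x"

definition pdt :: "(real \<Rightarrow> real \<Rightarrow> real) \<Rightarrow> real \<Rightarrow> real \<Rightarrow> real" where
  "pdt f x t = deriv (\<lambda>s. f x s) t"

text \<open>
  Functions of two real variables are curried. On an open set, being of class \<open>C\<^sup>k\<close> means
  that all iterated partial derivatives of order at most \<open>k\<close> exist and are continuous.
  Existence is required explicitly, because \<^const>\<open>deriv\<close> is total.
\<close>

fun Ck_on :: "nat \<Rightarrow> (real \<times> real) set \<Rightarrow> (real \<Rightarrow> real \<Rightarrow> real) \<Rightarrow> bool" where
  "Ck_on 0 S f \<longleftrightarrow> continuous_on S (\<lambda>(x, t). f x t)"
| "Ck_on (Suc k) S f \<longleftrightarrow>
     continuous_on S (\<lambda>(x, t). f x t) \<and>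
     (\<forall>(x, t) \<in> S. (\<lambda>s. f s t) differentiable (at x) \<and> (\<lambda>s. f x s) differentiable (at t)) \<and>
     Ck_on k S (pdx f) \<and> Ck_on k S (pdt f)"

definition smooth_on :: "(real \<times> real) set \<Rightarrow> (real \<Rightarrow> real \<Rightarrow> real) \<Rightarrow> bool" where
  "smooth_on S f \<longleftrightarrow> (\<forall>k. Ck_on k S f)"

definition upper_half :: "(real \<times> real) set" where
  "upper_half = {(x, t). t > 0}"

definition o_eps :: "(real \<Rightarrow> real) \<Rightarrow> bool" where
  "o_eps f \<longleftrightarrow> ((\<lambda>\<epsilon>. f \<epsilon> / \<epsilon>) \<longlongrightarrow> 0) (at 0)"

definition W :: "real \<Rightarrow> real \<Rightarrow> real \<Rightarrow> real" where
  "W c x t = (c - x) / (6 * t)"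

text \<open>
  A family \<open>w\<close> depending on the parameter \<open>\<epsilon>\<close> is written \<open>w \<epsilon> x t\<close>; the conditions
  modulo \<open>o(\<epsilon>)\<close> are imposed at each point \<open>(x, t)\<close> with \<open>t > 0\<close>.
\<close>

definition gardner :: "real \<Rightarrow> (real \<Rightarrow> real \<Rightarrow> real) \<Rightarrow> real \<Rightarrow> real \<Rightarrow> real" where
  "gardner \<epsilon> u x t =
     pdt u x t - 6 * (u x t + \<epsilon> * (u x t)\<^sup>2) * pdx u x t + pdx (pdx (pdx u)) x t"

definition approx_solution :: "(real \<Rightarrow> real \<Rightarrow> real \<Rightarrow> real) \<Rightarrow> bool" where
  "approx_solution w \<longleftrightarrow> (\<forall>(x, t) \<in> upper_half. o_eps (\<lambda>\<epsilon>. gardner \<epsilon> (w \<epsilon>) x t))"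

text \<open>Differential operators act on functions of the three variables \<open>(x, t, w)\<close>.\<close>

type_synonym fun3 = "real \<Rightarrow> real \<Rightarrow> real \<Rightarrow> real"

definition D_x :: "fun3 \<Rightarrow> fun3" where
  "D_x F x t w = deriv (\<lambda>s. F s t w) x"

definition D_t :: "fun3 \<Rightarrow> fun3" where
  "D_t F x t w = deriv (\<lambda>s. F x s w) t"

definition D_w :: "fun3 \<Rightarrow> fun3" where
  "D_w F x t w = deriv (\<lambda>s. F x t s) w"

definition X_op :: "real \<Rightarrow> real \<Rightarrow> real \<Rightarrow> real \<Rightarrow> real \<Rightarrow> fun3 \<Rightarrow> fun3" where
  "X_op k1 k2 k3 k4 \<epsilon> F x t w =
     6 * t * D_x F x t w + (2 * \<epsilon> * w - 1) * D_w F x t w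
     + \<epsilon> * (k1 * D_x F x t w
            + k2 * D_t F x t w
            + k3 * (6 * t * D_x F x t w - D_w F x t w)
            + k4 * (x * D_x F x t w + 3 * t * D_t F x t w - 2 * w * D_w F x t w))"

definition approx_invariant ::
    "(real \<Rightarrow> fun3 \<Rightarrow> fun3) \<Rightarrow> (real \<Rightarrow> real \<Rightarrow> real \<Rightarrow> real) \<Rightarrow> bool" where
  "approx_invariant X u \<longleftrightarrow>
     (\<forall>(x, t) \<in> upper_half. o_eps (\<lambda>\<epsilon>. X \<epsilon> (\<lambda>x t w. w - u \<epsilon> x t) x t (u \<epsilon> x t)))"

end

theory Submission
  imports Defs
begin

text \<open>
  Put \<open>u = W + \<epsilon> v\<close> with \<open>v\<close> fixed. At each point both conditions are polynomials in \<open>\<epsilon>\<close>.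
  Their constant terms vanish because \<open>W\<close> is invariant under the Galilean boost
  \<open>6 t \<partial>\<^sub>x - \<partial>\<^sub>w\<close> and solves the unperturbed equation, so being \<open>o(\<epsilon>)\<close> means exactly that
  the coefficient of \<open>\<epsilon>\<close> vanishes (\<open>o_eps_times_iff\<close>). With \<open>a = k\<^sub>1 + k\<^sub>4 c\<close> and \<open>b = k\<^sub>2\<close>, the
  resulting equations for \<open>v\<close> are

    \<open>v\<^sub>x = a / (36 t\<^sup>2) + b (c - x) / (36 t\<^sup>3) + (c - x) / (18 t\<^sup>2)\<close>  (\<open>approx_invariant_iff\<close>),

    \<open>v\<^sub>t - 6 W v\<^sub>x - 6 W\<^sub>x (v + W\<^sup>2) + v\<^sub>x\<^sub>x\<^sub>x = 0\<close>  (\<open>approx_solution_iff\<close>).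

  The boost coefficient \<open>k\<^sub>3\<close> disappears because \<open>W\<close> is boost invariant, and \<open>k\<^sub>4\<close> enters only
  through \<open>c\<close> because the scaling moves \<open>W\<close> within the family of all \<open>W\<close> by changing \<open>c\<close>.

  The first equation determines \<open>v\<close> up to its values on the line \<open>x = c\<close>. There \<open>W\<close> vanishes,
  and \<open>v\<^sub>x\<^sub>x\<^sub>x = 0\<close> everywhere since \<open>v\<^sub>x\<close> is affine in \<open>x\<close>, so the second equation reduces to
  \<open>v\<^sub>t + v / t = 0\<close>, that is, \<open>t v(c, t) = C\<close>. Conversely, substitution shows that the resulting
  functions satisfy both equations (\<open>determining_equations_iff\<close>), and they are smooth, being
  polynomials in \<open>x\<close> and \<open>1 / t\<close>.
\<close>

section \<open>Smooth functions on open sets of the plane\<close>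

lemma eventually_slices_in_open:
  fixes S :: "(real \<times> real) set"
  assumes "open S" "(x, t) \<in> S"
  shows "\<forall>\<^sub>F s in nhds x. (s, t) \<in> S" "\<forall>\<^sub>F s in nhds t. (x, s) \<in> S"
proof -
  have "open ((\<lambda>s. (s, t)) -` S)" "open ((\<lambda>s. (x, s)) -` S)"
    using assms by (auto intro!: open_vimage continuous_intros)
  then show "\<forall>\<^sub>F s in nhds x. (s, t) \<in> S" "\<forall>\<^sub>F s in nhds t. (x, s) \<in> S"
    using assms by (auto simp: eventually_nhds)
qed

lemma differentiable_cong_nhds:
  fixes f g :: "real \<Rightarrow> real"
  assumes "\<forall>\<^sub>F s in nhds x. f s = g s" "f differentiable (at x)"
  shows "g differentiable (at x)"
proof -
  obtain D where "(f has_real_derivative D) (at x)"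
    using assms(2) real_differentiable_def by blast
  then have "(g has_real_derivative D) (at x)"
    using DERIV_cong_ev[OF refl assms(1) refl] by simp
  then show ?thesis
    using real_differentiable_def by blast
qed

lemma pd_cong:
  assumes "open S" "(x, t) \<in> S" "\<And>x t. (x, t) \<in> S \<Longrightarrow> f x t = g x t"
  shows "pdx f x t = pdx g x t" "pdt f x t = pdt g x t"
  unfolding pdx_def pdt_def
  by (rule deriv_cong_ev; use eventually_slices_in_open[OF assms(1,2)] assms(3)
      in \<open>auto elim: eventually_mono\<close>)+

text \<open>
  The closed forms of derivatives used below hold only inside the set: at \<open>t = 0\<close> the value of
  \<^const>\<open>deriv\<close> is unspecified. Hence the need for this congruence.
\<close>
lemma Ck_on_cong:
  assumes "open S" "\<And>x t. (x, t) \<in> S \<Longrightarrow> f x t = g x t" "Ck_on k S f"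
  shows "Ck_on k S g"
  using assms(2,3)
proof (induction k arbitrary: f g)
  case 0
  then show ?case
    by (auto intro: continuous_on_eq)
next
  case (Suc k)
  have "continuous_on S (\<lambda>(x, t). g x t)"
    using Suc.prems by (auto intro: continuous_on_eq)
  moreover have "(\<lambda>s. g s t) differentiable (at x) \<and> (\<lambda>s. g x s) differentiable (at t)"
    if xt: "(x, t) \<in> S" for x t
  proof
    have "(\<lambda>s. f s t) differentiable (at x)" "(\<lambda>s. f x s) differentiable (at t)"
      using Suc.prems(2) xt by auto
    then show "(\<lambda>s. g s t) differentiable (at x)" "(\<lambda>s. g x s) differentiable (at t)"
      using eventually_slices_in_open[OF assms(1) xt] Suc.prems(1)
      by (auto elim!: differentiable_cong_nhds[rotated] elim: eventually_mono)
  qed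
  moreover have "Ck_on k S (pdx g)" "Ck_on k S (pdt g)"
    using Suc.IH[of "pdx f" "pdx g"] Suc.IH[of "pdt f" "pdt g"] Suc.prems
      pd_cong[OF assms(1), of _ _ f g] by auto
  ultimately show ?case
    by auto
qed

lemma Ck_on_SucI:
  assumes "open S"
    and "\<And>x t. (x, t) \<in> S \<Longrightarrow> ((\<lambda>s. f s t) has_real_derivative fx x t) (at x)"
    and "\<And>x t. (x, t) \<in> S \<Longrightarrow> ((\<lambda>s. f x s) has_real_derivative ft x t) (at t)"
    and "continuous_on S (\<lambda>(x, t). f x t)"
    and "Ck_on k S fx" "Ck_on k S ft"
  shows "Ck_on (Suc k) S f"
proof -
  have "Ck_on k S (pdx f)" "Ck_on k S (pdt f)"
    using DERIV_imp_deriv[OF assms(2)] DERIV_imp_deriv[OF assms(3)]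
    by (auto intro: Ck_on_cong[OF assms(1) _ assms(5)] Ck_on_cong[OF assms(1) _ assms(6)]
        simp: pdx_def pdt_def)
  then show ?thesis
    using assms(4) real_differentiable_def assms(2,3) by (simp only: Ck_on.simps) blast
qed

lemma Ck_on_Suc_derivs:
  assumes "Ck_on (Suc k) S f" "(x, t) \<in> S"
  shows "((\<lambda>s. f s t) has_real_derivative pdx f x t) (at x)"
    and "((\<lambda>s. f x s) has_real_derivative pdt f x t) (at t)"
  using assms by (auto simp: pdx_def pdt_def DERIV_deriv_iff_real_differentiable)

lemma Ck_on_continuous: "Ck_on k S f \<Longrightarrow> continuous_on S (\<lambda>(x, t). f x t)"
  by (cases k) auto

lemma Ck_on_SucD: "Ck_on (Suc k) S f \<Longrightarrow> Ck_on k S f"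
proof (induction k arbitrary: f)
  case (Suc k)
  have "Ck_on (Suc k) S (pdx f)" "Ck_on (Suc k) S (pdt f)"
    using Suc.prems by simp_all
  then have "Ck_on k S (pdx f)" "Ck_on k S (pdt f)"
    using Suc.IH by blast+
  with Suc.prems show ?case
    by simp
qed auto

lemma Ck_on_const: "open S \<Longrightarrow> Ck_on k S (\<lambda>x t. r)"
proof (induction k arbitrary: r)
  case (Suc k)
  show ?case
    by (rule Ck_on_SucI[where fx = "\<lambda>_ _. 0" and ft = "\<lambda>_ _. 0"])
      (use Suc in \<open>auto intro: continuous_intros\<close>)
qed auto

lemma Ck_on_fst: "open S \<Longrightarrow> Ck_on k S (\<lambda>x t. x)"
proof (cases k)
  case (Suc k')
  assume "open S"
  then show ?thesis
    unfolding Suc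
    by (intro Ck_on_SucI[where fx = "\<lambda>_ _. 1" and ft = "\<lambda>_ _. 0"])
      (auto intro!: continuous_intros Ck_on_const simp: case_prod_beta)
qed (auto simp: case_prod_beta intro: continuous_intros)

lemma Ck_on_add:
  assumes "open S" "Ck_on k S f" "Ck_on k S g"
  shows "Ck_on k S (\<lambda>x t. f x t + g x t)"
  using assms(2,3)
proof (induction k arbitrary: f g)
  case 0
  then show ?case
    by (auto simp: case_prod_beta intro: continuous_intros)
next
  case (Suc k)
  have pd: "Ck_on k S (pdx f)" "Ck_on k S (pdt f)" "Ck_on k S (pdx g)" "Ck_on k S (pdt g)"
    using Suc.prems by auto
  show ?case
  proof (rule Ck_on_SucI[OF assms(1)])
    show "((\<lambda>s. f s t + g s t) has_real_derivative pdx f x t + pdx g x t) (at x)"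
      "((\<lambda>s. f x s + g x s) has_real_derivative pdt f x t + pdt g x t) (at t)"
      if "(x, t) \<in> S" for x t
      by (rule DERIV_add Ck_on_Suc_derivs Suc.prems that)+
    show "continuous_on S (\<lambda>(x, t). f x t + g x t)"
      using Ck_on_continuous[OF Suc.prems(1)] Ck_on_continuous[OF Suc.prems(2)]
      by (auto simp: case_prod_beta intro: continuous_intros)
    show "Ck_on k S (\<lambda>x t. pdx f x t + pdx g x t)"
      "Ck_on k S (\<lambda>x t. pdt f x t + pdt g x t)"
      by (rule Suc.IH; rule pd)+
  qed
qed

lemma Ck_on_mult:
  assumes "open S" "Ck_on k S f" "Ck_on k S g"
  shows "Ck_on k S (\<lambda>x t. f x t * g x t)"
  using assms(2,3)
proof (induction k arbitrary: f g)
  case 0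
  then show ?case
    by (auto simp: case_prod_beta intro: continuous_intros)
next
  case (Suc k)
  note fg = Ck_on_SucD[OF Suc.prems(1)] Ck_on_SucD[OF Suc.prems(2)]
  have pd: "Ck_on k S (pdx f)" "Ck_on k S (pdt f)" "Ck_on k S (pdx g)" "Ck_on k S (pdt g)"
    using Suc.prems by auto
  show ?case
  proof (rule Ck_on_SucI[OF assms(1)])
    show "((\<lambda>s. f s t * g s t) has_real_derivative pdx f x t * g x t + pdx g x t * f x t) (at x)"
      "((\<lambda>s. f x s * g x s) has_real_derivative pdt f x t * g x t + pdt g x t * f x t) (at t)"
      if "(x, t) \<in> S" for x t
      by (rule DERIV_mult Ck_on_Suc_derivs Suc.prems that)+
    show "continuous_on S (\<lambda>(x, t). f x t * g x t)"
      using Ck_on_continuous[OF Suc.prems(1)] Ck_on_continuous[OF Suc.prems(2)]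
      by (auto simp: case_prod_beta intro: continuous_intros)
    show "Ck_on k S (\<lambda>x t. pdx f x t * g x t + pdx g x t * f x t)"
      "Ck_on k S (\<lambda>x t. pdt f x t * g x t + pdt g x t * f x t)"
      by (rule Ck_on_add[OF assms(1)]; rule Suc.IH; rule fg pd)+
  qed
qed

lemma open_upper_half: "open upper_half"
proof -
  have *: "upper_half = UNIV \<times> {0<..}"
    by (auto simp: upper_half_def)
  show ?thesis
    unfolding * by (intro open_Times open_UNIV open_greaterThan)
qed

lemma mem_upper_half [simp]: "(x, t) \<in> upper_half \<longleftrightarrow> t > 0"
  by (simp add: upper_half_def)

lemma ball_upper_half [simp]:
  "(\<forall>(x, t) \<in> upper_half. P x t) \<longleftrightarrow> (\<forall>x t. t > 0 \<longrightarrow> P x t)"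
  by (auto simp: upper_half_def)

text \<open>
  The derivative \<open>- (1 / t)\<^sup>2\<close> is a polynomial in the function itself, so closure under products
  lifts the order of differentiability by one.
\<close>
lemma Ck_on_inverse_snd: "Ck_on k upper_half (\<lambda>x t. inverse t)"
proof (induction k)
  case 0
  show ?case
    by (auto simp: case_prod_beta upper_half_def intro!: continuous_intros)
next
  case (Suc k)
  show ?case
  proof (rule Ck_on_SucI[where fx = "\<lambda>_ _. 0" and ft = "\<lambda>x t. - 1 * (inverse t * inverse t)"])
    show "continuous_on upper_half (\<lambda>(x, t). inverse t)"
      using Ck_on_continuous[OF Suc] .
    show "Ck_on k upper_half (\<lambda>x t. - 1 * (inverse t * inverse t))"
      by (intro Ck_on_mult Ck_on_const open_upper_half Suc)
    show "((\<lambda>s. inverse s) has_real_derivative - 1 * (inverse t * inverse t)) (at t)"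
      if "(x, t) \<in> upper_half" for x t :: real
      using that DERIV_inverse[of t UNIV] by (simp add: power2_eq_square)
  qed (simp_all add: open_upper_half Ck_on_const)
qed

section \<open>The determining equations for the first-order term\<close>

lemma o_eps_times_iff:
  assumes "\<And>\<epsilon>. f \<epsilon> = \<epsilon> * q \<epsilon>" "isCont q 0"
  shows "o_eps f \<longleftrightarrow> q 0 = 0"
proof -
  have q: "(q \<longlongrightarrow> q 0) (at 0)"
    using assms(2) by (simp add: isCont_def)
  have "o_eps f \<longleftrightarrow> (q \<longlongrightarrow> 0) (at 0)"
    unfolding o_eps_def by (intro filterlim_cong) (auto simp: assms(1) eventually_at_filter)
  also have "\<dots> \<longleftrightarrow> q 0 = 0"
    using q tendsto_unique[OF at_neq_bot, of q] by metis
  finally show ?thesis .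
qed

lemma W_derivs:
  assumes "t > 0"
  shows "((\<lambda>s. W c s t) has_real_derivative - 1 / (6 * t)) (at x)"
    and "((\<lambda>s. W c x s) has_real_derivative - (c - x) / (6 * t\<^sup>2)) (at t)"
  using assms unfolding W_def
  by (auto intro!: derivative_eq_intros simp: field_simps power2_eq_square)

locale perturbed_galilean =
  fixes c :: real and v :: "real \<Rightarrow> real \<Rightarrow> real" and w :: "real \<Rightarrow> real \<Rightarrow> real \<Rightarrow> real"
  assumes v_smooth: "smooth_on upper_half v"
    and w_eq: "t > 0 \<Longrightarrow> w \<epsilon> x t = W c x t + \<epsilon> * v x t"
begin

lemma v_Ck: "Ck_on k upper_half v"
  using v_smooth by (simp add: smooth_on_def)

lemma v_derivs:
  assumes "t > 0"
  shows "((\<lambda>s. v s t) has_real_derivative pdx v x t) (at x)"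
    and "((\<lambda>s. v x s) has_real_derivative pdt v x t) (at t)"
    and "((\<lambda>s. pdx v s t) has_real_derivative pdx (pdx v) x t) (at x)"
    and "((\<lambda>s. pdx (pdx v) s t) has_real_derivative pdx (pdx (pdx v)) x t) (at x)"
proof -
  have "Ck_on (Suc 1) upper_half (pdx v)" "Ck_on (Suc 0) upper_half (pdx (pdx v))"
    using v_Ck[of 3] by (simp_all add: numeral_eq_Suc)
  then show "((\<lambda>s. v s t) has_real_derivative pdx v x t) (at x)"
    "((\<lambda>s. v x s) has_real_derivative pdt v x t) (at t)"
    "((\<lambda>s. pdx v s t) has_real_derivative pdx (pdx v) x t) (at x)"
    "((\<lambda>s. pdx (pdx v) s t) has_real_derivative pdx (pdx (pdx v)) x t) (at x)"
    using assms by (auto intro!: Ck_on_Suc_derivs v_Ck simp del: Ck_on.simps)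
qed

lemma w_derivs:
  assumes "t > 0"
  shows "((\<lambda>s. w \<epsilon> s t) has_real_derivative - 1 / (6 * t) + \<epsilon> * pdx v x t) (at x)"
    and "((\<lambda>s. w \<epsilon> x s) has_real_derivative - (c - x) / (6 * t\<^sup>2) + \<epsilon> * pdt v x t) (at t)"
proof -
  show "((\<lambda>s. w \<epsilon> s t) has_real_derivative - 1 / (6 * t) + \<epsilon> * pdx v x t) (at x)"
    unfolding w_eq[OF assms] by (intro DERIV_add DERIV_cmult W_derivs v_derivs assms)
  have "((\<lambda>s. W c x s + \<epsilon> * v x s) has_real_derivative
      - (c - x) / (6 * t\<^sup>2) + \<epsilon> * pdt v x t) (at t)"
    by (intro DERIV_add DERIV_cmult W_derivs v_derivs assms)
  moreover have "\<forall>\<^sub>F s in nhds t. w \<epsilon> x s = W c x s + \<epsilon> * v x s"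
    using eventually_slices_in_open(2)[OF open_upper_half, of x t] assms
    by (auto elim!: eventually_mono simp: w_eq)
  ultimately show "((\<lambda>s. w \<epsilon> x s) has_real_derivative
      - (c - x) / (6 * t\<^sup>2) + \<epsilon> * pdt v x t) (at t)"
    using DERIV_cong_ev[OF refl _ refl, where f = "\<lambda>s. w \<epsilon> x s"
        and g = "\<lambda>s. W c x s + \<epsilon> * v x s"] by simp
qed

lemma pd_w:
  assumes "t > 0"
  shows "pdx (w \<epsilon>) x t = - 1 / (6 * t) + \<epsilon> * pdx v x t"
    and "pdt (w \<epsilon>) x t = - (c - x) / (6 * t\<^sup>2) + \<epsilon> * pdt v x t"
    and "pdx (pdx (pdx (w \<epsilon>))) x t = \<epsilon> * pdx (pdx (pdx v)) x t"
proof -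
  show x1: "pdx (w \<epsilon>) x t = - 1 / (6 * t) + \<epsilon> * pdx v x t" for x
    unfolding pdx_def[of "w \<epsilon>"] by (intro DERIV_imp_deriv w_derivs assms)
  show "pdt (w \<epsilon>) x t = - (c - x) / (6 * t\<^sup>2) + \<epsilon> * pdt v x t"
    unfolding pdt_def[of "w \<epsilon>"] by (intro DERIV_imp_deriv w_derivs assms)
  have x2: "pdx (pdx (w \<epsilon>)) x t = \<epsilon> * pdx (pdx v) x t" for x
    unfolding pdx_def[of "pdx (w \<epsilon>)"] x1
    by (rule DERIV_imp_deriv) (auto intro!: derivative_eq_intros v_derivs assms)
  show "pdx (pdx (pdx (w \<epsilon>))) x t = \<epsilon> * pdx (pdx (pdx v)) x t"
    unfolding pdx_def[of "pdx (pdx (w \<epsilon>))"] x2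
    by (intro DERIV_imp_deriv DERIV_cmult v_derivs assms)
qed

lemma X_op_graph:
  assumes "t > 0"
  shows "X_op k1 k2 k3 k4 \<epsilon> (\<lambda>x t z. z - w \<epsilon> x t) x t (w \<epsilon> x t) =
    - 6 * t * pdx (w \<epsilon>) x t + (2 * \<epsilon> * w \<epsilon> x t - 1)
     + \<epsilon> * (- k1 * pdx (w \<epsilon>) x t - k2 * pdt (w \<epsilon>) x t
            - k3 * (6 * t * pdx (w \<epsilon>) x t + 1)
            - k4 * (x * pdx (w \<epsilon>) x t + 3 * t * pdt (w \<epsilon>) x t + 2 * w \<epsilon> x t))"
proof -
  let ?F = "\<lambda>x t z. z - w \<epsilon> x t"
  have "D_x ?F x t z = - pdx (w \<epsilon>) x t" "D_t ?F x t z = - pdt (w \<epsilon>) x t" "D_w ?F x t z = 1" for z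
    unfolding D_x_def D_t_def D_w_def pd_w[OF assms]
    by (rule DERIV_imp_deriv, (rule derivative_eq_intros w_derivs assms refl)+, simp)+
  then show ?thesis
    unfolding X_op_def by (simp add: algebra_simps)
qed

lemma approx_invariant_iff:
  "approx_invariant (X_op k1 k2 k3 k4) w \<longleftrightarrow>
    (\<forall>x t. t > 0 \<longrightarrow> pdx v x t =
      (k1 + k4 * c) / (36 * t\<^sup>2) + k2 * (c - x) / (36 * t ^ 3) + (c - x) / (18 * t\<^sup>2))"
proof -
  have "o_eps (\<lambda>\<epsilon>. X_op k1 k2 k3 k4 \<epsilon> (\<lambda>x t z. z - w \<epsilon> x t) x t (w \<epsilon> x t)) \<longleftrightarrow>
    pdx v x t = (k1 + k4 * c) / (36 * t\<^sup>2) + k2 * (c - x) / (36 * t ^ 3) + (c - x) / (18 * t\<^sup>2)"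
    if t: "t > 0" for x t
  proof -
    define q where "q = (\<lambda>\<epsilon>. - 6 * t * pdx v x t + 2 * (W c x t + \<epsilon> * v x t)
      - k1 * (- 1 / (6 * t) + \<epsilon> * pdx v x t)
      - k2 * (- (c - x) / (6 * t\<^sup>2) + \<epsilon> * pdt v x t)
      - k3 * (6 * t * (\<epsilon> * pdx v x t))
      - k4 * (x * (- 1 / (6 * t) + \<epsilon> * pdx v x t)
        + 3 * t * (- (c - x) / (6 * t\<^sup>2) + \<epsilon> * pdt v x t) + 2 * (W c x t + \<epsilon> * v x t)))"
    have "X_op k1 k2 k3 k4 \<epsilon> (\<lambda>x t z. z - w \<epsilon> x t) x t (w \<epsilon> x t) = \<epsilon> * q \<epsilon>" for \<epsilon>
    proof -
      \<comment> \<open>boost invariance of \<open>W\<close>: the \<open>-1\<close> cancels the \<open>\<epsilon>\<close>-free term of \<^const>\<open>X_op\<close>\<close>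
      have "6 * t * (- 1 / (6 * t) + \<epsilon> * pdx v x t) = - 1 + 6 * t * (\<epsilon> * pdx v x t)"
        using t by (simp add: field_simps)
      then show ?thesis
        unfolding X_op_graph[OF t] unfolding pd_w[OF t] w_eq[OF t] q_def by algebra
    qed
    moreover have "isCont q 0"
      unfolding q_def by (intro continuous_intros)
    ultimately have "o_eps (\<lambda>\<epsilon>. X_op k1 k2 k3 k4 \<epsilon> (\<lambda>x t z. z - w \<epsilon> x t) x t (w \<epsilon> x t))
      \<longleftrightarrow> q 0 = 0"
      by (rule o_eps_times_iff)
    also have "q 0 = 6 * t * ((k1 + k4 * c) / (36 * t\<^sup>2) + k2 * (c - x) / (36 * t ^ 3)
        + (c - x) / (18 * t\<^sup>2) - pdx v x t)"
      using t by (simp add: q_def W_def field_simps power2_eq_square power3_eq_cube)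
    finally show ?thesis
      using t by auto
  qed
  then show ?thesis
    unfolding approx_invariant_def by auto
qed

lemma approx_solution_iff:
  "approx_solution w \<longleftrightarrow>
    (\<forall>x t. t > 0 \<longrightarrow> pdt v x t - 6 * W c x t * pdx v x t + (v x t + (W c x t)\<^sup>2) / t
      + pdx (pdx (pdx v)) x t = 0)"
proof -
  have "o_eps (\<lambda>\<epsilon>. gardner \<epsilon> (w \<epsilon>) x t) \<longleftrightarrow>
    pdt v x t - 6 * W c x t * pdx v x t + (v x t + (W c x t)\<^sup>2) / t
      + pdx (pdx (pdx v)) x t = 0"
    if t: "t > 0" for x t
  proof -
    define q where "q = (\<lambda>\<epsilon>. pdt v x t - 6 * W c x t * pdx v x t
      - 6 * (v x t + (W c x t + \<epsilon> * v x t)\<^sup>2) * (- 1 / (6 * t) + \<epsilon> * pdx v x t)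
      + pdx (pdx (pdx v)) x t)"
    \<comment> \<open>\<open>W\<^sub>t = 6 W W\<^sub>x\<close>, which removes the \<open>\<epsilon>\<close>-free terms\<close>
    have KdV: "- (c - x) / (6 * t\<^sup>2) = 6 * W c x t * (- 1 / (6 * t))"
      using t by (simp add: W_def field_simps power2_eq_square)
    have "gardner \<epsilon> (w \<epsilon>) x t = \<epsilon> * q \<epsilon>" for \<epsilon>
      unfolding gardner_def pd_w[OF t] w_eq[OF t] q_def KdV
      by algebra
    moreover have "isCont q 0"
      unfolding q_def by (intro continuous_intros)
    ultimately have "o_eps (\<lambda>\<epsilon>. gardner \<epsilon> (w \<epsilon>) x t) \<longleftrightarrow> q 0 = 0"
      by (rule o_eps_times_iff)
    also have "q 0 = pdt v x t - 6 * W c x t * pdx v x t + (v x t + (W c x t)\<^sup>2) / t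
      + pdx (pdx (pdx v)) x t"
      using t by (simp add: q_def field_simps)
    finally show ?thesis .
  qed
  then show ?thesis
    unfolding approx_solution_def by auto
qed

end

section \<open>Solving the determining equations\<close>

definition first_order_term ::
    "real \<Rightarrow> real \<Rightarrow> real \<Rightarrow> real \<Rightarrow> real \<Rightarrow> real \<Rightarrow> real" where
  "first_order_term c a b C x t =
     - (a * (c - x) / (36 * t\<^sup>2)) - b * ((c - x)\<^sup>2 / (72 * t ^ 3)) - ((c - x) / (6 * t))\<^sup>2 + C / t"

lemma smooth_first_order_term: "smooth_on upper_half (first_order_term c a b C)"
  unfolding smooth_on_def
proof
  fix k
  let ?y = "\<lambda>x. c + - 1 * x"
  have "Ck_on k upper_half (\<lambda>x t.
      - a / 36 * (?y x * (inverse t * inverse t))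
      + (- b / 72 * ((?y x * ?y x) * (inverse t * (inverse t * inverse t)))
      + (- 1 / 36 * ((?y x * ?y x) * (inverse t * inverse t)) + C * inverse t)))"
    by (intro Ck_on_add Ck_on_mult Ck_on_const Ck_on_fst Ck_on_inverse_snd open_upper_half)
  then show "Ck_on k upper_half (first_order_term c a b C)"
    by (rule Ck_on_cong[OF open_upper_half, rotated])
      (simp add: first_order_term_def field_simps power2_eq_square power3_eq_cube)
qed

lemma first_order_term_derivs:
  assumes "t > 0"
  shows "((\<lambda>s. first_order_term c a b C s t) has_real_derivative
      a / (36 * t\<^sup>2) + b * (c - x) / (36 * t ^ 3) + (c - x) / (18 * t\<^sup>2)) (at x)"
    and "((\<lambda>s. first_order_term c a b C x s) has_real_derivative
      a * (c - x) / (18 * t ^ 3) + b * (c - x)\<^sup>2 / (24 * t ^ 4) + (c - x)\<^sup>2 / (18 * t ^ 3)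
      - C / t\<^sup>2) (at t)"
  using assms unfolding first_order_term_def
  by (auto intro!: derivative_eq_intros simp: field_simps eval_nat_numeral)

text \<open>
  Stated for the derivative rather than for the solution, since the \<open>x\<close>-equation gives this
  derivative before the solution is known.
\<close>
lemma pdx3_eq_0_if_pdx_affine:
  assumes "\<And>x. pdx v x t = p + q * (c - x)"
  shows "pdx (pdx (pdx v)) x t = 0"
proof -
  have "pdx (pdx v) x t = - q" for x
    unfolding pdx_def[of "pdx v"] assms
    by (rule DERIV_imp_deriv) (auto intro!: derivative_eq_intros)
  then show ?thesis
    unfolding pdx_def[of "pdx (pdx v)"] by simp
qed

text \<open>
  Two functions with the same \<open>x\<close>-derivative that agree on \<open>x = c\<close> are equal, so it suffices to
  find \<open>v\<close> on that line.
\<close>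
lemma determining_equations_iff:
  assumes dx: "\<And>x t. t > 0 \<Longrightarrow> ((\<lambda>s. v s t) has_real_derivative pdx v x t) (at x)"
    and dt: "\<And>x t. t > 0 \<Longrightarrow> ((\<lambda>s. v x s) has_real_derivative pdt v x t) (at t)"
  shows "(\<forall>x t. t > 0 \<longrightarrow> pdx v x t =
            a / (36 * t\<^sup>2) + b * (c - x) / (36 * t ^ 3) + (c - x) / (18 * t\<^sup>2)) \<and>
         (\<forall>x t. t > 0 \<longrightarrow> pdt v x t - 6 * W c x t * pdx v x t + (v x t + (W c x t)\<^sup>2) / t
            + pdx (pdx (pdx v)) x t = 0)
    \<longleftrightarrow> (\<exists>C. \<forall>x t. t > 0 \<longrightarrow> v x t = first_order_term c a b C x t)"
    (is "?inv \<and> ?sol \<longleftrightarrow> ?form")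
proof -
  have xxx: "pdx (pdx (pdx v)) x t = 0" if ?inv "t > 0" for x t
    by (rule pdx3_eq_0_if_pdx_affine[where c = c and p = "a / (36 * t\<^sup>2)"
          and q = "b / (36 * t ^ 3) + 1 / (18 * t\<^sup>2)"])
      (use that in \<open>simp add: algebra_simps\<close>)
  show ?thesis
  proof
    assume eqs: "?inv \<and> ?sol"
    have "((\<lambda>s. s * v c s) has_real_derivative 0) (at t within {0<..})" if t: "t > 0" for t
    proof -
      have "pdt v c t + v c t / t = 0"
      proof -
        have "pdt v c t - 6 * W c c t * pdx v c t + (v c t + (W c c t)\<^sup>2) / t
            + pdx (pdx (pdx v)) c t = 0"
          using eqs t by blast
        then show ?thesis
          using eqs xxx[of t c] t by (simp add: W_def)
      qed
      then have "t * pdt v c t + v c t = 0"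
        using t by (simp add: field_simps)
      then have "((\<lambda>s. s * v c s) has_real_derivative 0) (at t)"
        by (auto intro!: derivative_eq_intros dt t simp: algebra_simps)
      then show ?thesis
        by (rule has_field_derivative_at_within)
    qed
    then obtain C where C: "\<And>t. t > 0 \<Longrightarrow> t * v c t = C"
      using has_field_derivative_zero_constant[of "{0::real<..}" "\<lambda>s. s * v c s"] by auto
    have "v x t = first_order_term c a b C x t" if t: "t > 0" for x t
    proof -
      have "((\<lambda>s. v s t - first_order_term c a b C s t) has_real_derivative 0) (at s)" for s
        using DERIV_diff[OF dx[OF t] first_order_term_derivs(1)[OF t, of c a b C s]] eqs t by simp
      then have "v x t - first_order_term c a b C x t = v c t - first_order_term c a b C c t"
        by (intro DERIV_isconst_all) blast
      also have "\<dots> = 0"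
        using C[OF t] t by (auto simp: first_order_term_def)
      finally show ?thesis
        by simp
    qed
    then show ?form
      by blast
  next
    assume ?form
    then obtain C where v: "\<And>x t. t > 0 \<Longrightarrow> v x t = first_order_term c a b C x t"
      by blast
    have px: "pdx v x t = a / (36 * t\<^sup>2) + b * (c - x) / (36 * t ^ 3) + (c - x) / (18 * t\<^sup>2)"
      and pt: "pdt v x t = a * (c - x) / (18 * t ^ 3) + b * (c - x)\<^sup>2 / (24 * t ^ 4)
        + (c - x)\<^sup>2 / (18 * t ^ 3) - C / t\<^sup>2" if t: "t > 0" for x t
      using pd_cong[OF open_upper_half, of x t v "first_order_term c a b C"] v t
        first_order_term_derivs[OF t, THEN DERIV_imp_deriv]
      by (auto simp: pdx_def pdt_def)
    have inv: ?inv
      using px by blast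
    moreover have "pdt v x t - 6 * W c x t * pdx v x t + (v x t + (W c x t)\<^sup>2) / t
        + pdx (pdx (pdx v)) x t = 0" if t: "t > 0" for x t
    proof -
      define y where "y = c - x"
      show ?thesis
        unfolding px[OF t] pt[OF t] xxx[OF inv t] v[OF t] first_order_term_def W_def y_def[symmetric]
        using t by (simp add: field_simps eval_nat_numeral)
    qed
    ultimately show "?inv \<and> ?sol"
      by blast
  qed
qed

section \<open>Approximately invariant solutions\<close>

theorem mainTheorem3:
  fixes c k1 k2 k3 k4 :: real
    and w :: "real \<Rightarrow> real \<Rightarrow> real \<Rightarrow> real"
  shows "((\<exists>v. smooth_on upper_half v \<and>
              (\<forall>\<epsilon>. \<forall>(x, t) \<in> upper_half. w \<epsilon> x t = W c x t + \<epsilon> * v x t)) \<and>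
          approx_invariant (X_op k1 k2 k3 k4) w \<and>
          approx_solution w)
     \<longleftrightarrow>
         (\<exists>C. \<forall>\<epsilon>. \<forall>(x, t) \<in> upper_half.
            w \<epsilon> x t = (c - x) / (6 * t)
              + \<epsilon> * (- ((k1 + k4 * c) * (c - x) / (36 * t\<^sup>2))
                     - k2 * ((c - x)\<^sup>2 / (72 * t ^ 3))
                     - ((c - x) / (6 * t))\<^sup>2
                     + C / t))"
proof -
  have key: "approx_invariant (X_op k1 k2 k3 k4) w \<and> approx_solution w \<longleftrightarrow>
      (\<exists>C. \<forall>x t. t > 0 \<longrightarrow> v x t = first_order_term c (k1 + k4 * c) k2 C x t)"
    if "smooth_on upper_half v"
      "\<forall>\<epsilon>. \<forall>(x, t) \<in> upper_half. w \<epsilon> x t = W c x t + \<epsilon> * v x t" for v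
  proof -
    interpret perturbed_galilean c v w
      using that by unfold_locales auto
    show ?thesis
      unfolding approx_invariant_iff approx_solution_iff
      by (rule determining_equations_iff) (rule v_derivs; assumption)+
  qed
  show ?thesis
    \<comment> \<open>folded in this order, as the square inside the first-order term contains \<open>W\<close>\<close>
    unfolding first_order_term_def[symmetric]
    unfolding W_def[symmetric]
  proof
    assume *: "(\<exists>v. smooth_on upper_half v \<and>
        (\<forall>\<epsilon>. \<forall>(x, t) \<in> upper_half. w \<epsilon> x t = W c x t + \<epsilon> * v x t)) \<and>
      approx_invariant (X_op k1 k2 k3 k4) w \<and> approx_solution w"
    then obtain v where v: "smooth_on upper_half v"
      "\<forall>\<epsilon>. \<forall>(x, t) \<in> upper_half. w \<epsilon> x t = W c x t + \<epsilon> * v x t"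
      by blast
    then obtain C where "\<forall>x t. t > 0 \<longrightarrow> v x t = first_order_term c (k1 + k4 * c) k2 C x t"
      using key * by blast
    with v(2) show "\<exists>C. \<forall>\<epsilon>. \<forall>(x, t) \<in> upper_half. w \<epsilon> x t =
        W c x t + \<epsilon> * first_order_term c (k1 + k4 * c) k2 C x t"
      by auto
  next
    assume "\<exists>C. \<forall>\<epsilon>. \<forall>(x, t) \<in> upper_half. w \<epsilon> x t =
        W c x t + \<epsilon> * first_order_term c (k1 + k4 * c) k2 C x t"
    then show "(\<exists>v. smooth_on upper_half v \<and>
        (\<forall>\<epsilon>. \<forall>(x, t) \<in> upper_half. w \<epsilon> x t = W c x t + \<epsilon> * v x t)) \<and>
      approx_invariant (X_op k1 k2 k3 k4) w \<and> approx_solution w"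
      using key smooth_first_order_term by blast
  qed
qed

end
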